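(* Let $\lambda$ be a nonzero real number and let $n\ge r\ge 0$ be integers. Then $$S_\lambda(n+1,r+1)=\frac{n!}{r!}\,\lambda^{n-r}\,Bel_r\Big(H_n^{(1)},\,(-1)\,1!\,H_n^{(2)},\,\dots,\,(-1)^{r-1}(r-1)!\,H_n^{(r)}\Big),$$ where $H_n^{(i)}=\sum_{k=1}^n \frac{1}{k^i}$ is the harmonic number of order $i$.
   Context: For real $\lambda$, the degenerate rising factorials are $\langle x\rangle_{0,\lambda}=1$ and $\langle x\rangle_{n,\lambda}=x(x+\lambda)(x+2\lambda)\cdots(x+(n-1)\lambda)$ for $n\ge1$. The unsigned degenerate Stirling numbers of the first kind $S_\lambda(n,k)$ are defined by $\langle x\rangle_{n,\lambda}=\sum_{k=0}^n S_\lambda(n,k)x^k$. The complete Bell polynomials $Bel_r(x_1,\dots,x_r)$ are defined by $\exp\big(\sum_{j\ge1}x_j\frac{t^j}{j!}\big)=\sum_{r\ge0}Bel_r(x_1,\dots,x_r)\frac{t^r}{r!}$; equivalently $Bel_r(x_1,\dots,x_r)=\sum_{k_1+2k_2+\cdots+rk_r=r}\frac{r!}{k_1!\cdots k_r!}\prod_{j=1}^r\big(\frac{x_j}{j!}\big)^{k_j}$ (so $Bel_0=1$). *)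

theory Defs
  imports "HOL-Computational_Algebra.Computational_Algebra"
begin

definition deg_rising :: "'a::comm_semiring_1 \<Rightarrow> nat \<Rightarrow> 'a \<Rightarrow> 'a" where
  "deg_rising lam n x = (\<Prod>i<n. x + of_nat i * lam)"

text \<open>The indeterminate \<open>x\<close> is the polynomial \<^term>\<open>[:0, 1:]\<close>, so that the numbers are the
  coefficients of the degenerate rising factorial as a polynomial in \<open>x\<close>; the defining expansion
  is the lemma \<open>deg_rising_expansion\<close>.\<close>

definition deg_stirling1 :: "real \<Rightarrow> nat \<Rightarrow> nat \<Rightarrow> real" where
  "deg_stirling1 lam n k = coeff (deg_rising [:lam:] n [:0, 1:]) k"

text \<open>The arguments $x_1, x_2, \dots$ form a sequence indexed from 1; its value at 0 is ignored,
  and by the lemma \<open>complete_bell_cong\<close> only $x_1,\dots,x_r$ matter for index \<open>r\<close>.\<close>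

definition complete_bell :: "nat \<Rightarrow> (nat \<Rightarrow> real) \<Rightarrow> real" where
  "complete_bell r x =
     fact r * fps_nth (fps_exp 1 oo Abs_fps (\<lambda>j. if j = 0 then 0 else x j / fact j)) r"

definition gen_harmonic :: "nat \<Rightarrow> nat \<Rightarrow> real" where
  "gen_harmonic n i = (\<Sum>k=1..n. 1 / real k ^ i)"

lemma degree_deg_rising: "degree (deg_rising [:lam:] n [:0, 1:] :: real poly) \<le> n"
proof (induction n)
  case 0
  then show ?case by (simp add: deg_rising_def)
next
  case (Suc n)
  have "degree ([:0, 1:] + of_nat n * [:lam:] :: real poly) \<le> 1"
    by (simp add: of_nat_poly)
  then have "degree (deg_rising [:lam:] n [:0, 1:] * ([:0, 1:] + of_nat n * [:lam:])) \<le> n + 1"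
    using Suc degree_mult_le le_trans add_mono by blast
  then show ?case by (simp add: deg_rising_def)
qed

lemma deg_rising_expansion: "deg_rising lam n x = (\<Sum>k\<le>n. deg_stirling1 lam n k * x ^ k)"
proof -
  have "deg_rising lam n x = poly (deg_rising [:lam:] n [:0, 1:]) x"
    by (simp add: deg_rising_def poly_prod of_nat_poly algebra_simps)
  also have "\<dots> = (\<Sum>k\<le>n. deg_stirling1 lam n k * x ^ k)"
    unfolding deg_stirling1_def poly_altdef using degree_deg_rising[of lam n]
    by (intro sum.mono_neutral_left) (auto simp: coeff_eq_0)
  finally show ?thesis .
qed

lemma complete_bell_egf:
  "fps_exp 1 oo Abs_fps (\<lambda>j. if j = 0 then 0 else x j / fact j)
     = Abs_fps (\<lambda>r. complete_bell r x / fact r)"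
  by (simp add: complete_bell_def fps_eq_iff)

lemma complete_bell_0: "complete_bell 0 x = 1"
  by (simp add: complete_bell_def)

lemma complete_bell_cong:
  assumes "\<And>j. 1 \<le> j \<Longrightarrow> j \<le> r \<Longrightarrow> x j = y j"
  shows "complete_bell r x = complete_bell r y"
proof -
  let ?A = "\<lambda>x. Abs_fps (\<lambda>j. if j = 0 then 0 else x j / fact j) :: real fps"
  have "fps_nth (?A x ^ i) m = fps_nth (?A y ^ i) m" if "m \<le> r" for i m
    using that
  proof (induction i arbitrary: m)
    case (Suc i)
    then show ?case using assms by (auto simp: fps_mult_nth intro!: sum.cong)
  qed simp
  then show ?thesis by (simp add: complete_bell_def fps_compose_nth)
qed

end

theory Submission
  imports Defs
begin

text \<open>Since $\log(1 + t/k) = \sum_{j\ge1} (-1)^{j-1} t^j / (j k^j)$, the exponential generating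
  function of the Bell polynomials at the given arguments is $\prod_{k=1}^n (1 + t/k)$. Up to the
  factor $n!\,\lambda^n$ and the substitution $x = \lambda t$, this is
  $\prod_{k=1}^n (x + k\lambda) = \langle x\rangle_{n+1,\lambda} / x$.\<close>

text \<open>Both series solve the linear differential equation \<open>F' = F * A'\<close> with
  constant coefficient 1. Comparing coefficients at \<open>k\<close> expresses
  \<open>(k + 1) * F_(k+1)\<close> through \<open>F_0, ..., F_k\<close>, so in characteristic 0 the
  solution is unique. This replaces any use of a formal logarithm.\<close>

lemma fps_exp_compose_eqI:
  fixes A G :: "'a::field_char_0 fps"
  assumes "fps_nth A 0 = 0" "fps_nth G 0 = 1" "fps_deriv G = G * fps_deriv A"
  shows "fps_exp 1 oo A = G"
proof -
  define F where "F = fps_exp 1 oo A"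
  have F: "fps_deriv F = F * fps_deriv A"
    using assms(1) by (simp add: F_def fps_compose_deriv)
  have "fps_nth F m = fps_nth G m" for m
  proof (induction m rule: less_induct)
    case (less m)
    show ?case
    proof (cases m)
      case 0
      then show ?thesis using assms by (simp add: F_def)
    next
      case (Suc k)
      have "fps_nth (fps_deriv F) k = fps_nth (fps_deriv G) k"
        unfolding F assms(3) fps_mult_nth using less Suc by (intro sum.cong) auto
      then show ?thesis using Suc by (simp del: of_nat_Suc)
    qed
  qed
  then show ?thesis by (simp add: F_def fps_eq_iff)
qed

text \<open>It suffices that the product has logarithmic derivative \<open>A'\<close>. This goes by
  induction on \<open>n\<close>: each new factor \<open>1 + c * X\<close> contributes
  \<open>c / (1 + c * X)\<close>, which is exactly the growth of \<open>A'\<close>.\<close>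

lemma complete_bell_egf_harmonic:
  "fps_exp 1 oo Abs_fps (\<lambda>j. if j = 0 then 0
       else (-1) ^ (j - 1) * fact (j - 1) * gen_harmonic n j / fact j)
     = (\<Prod>k=1..n. 1 + fps_const (1 / real k) * fps_X)"
proof (rule fps_exp_compose_eqI)
  define A where "A n = Abs_fps (\<lambda>j. if j = 0 then 0
       else (-1) ^ (j - 1) * fact (j - 1) * gen_harmonic n j / fact j)" for n
  \<comment> \<open>The factor \<open>j + 1\<close> from differentiation and \<open>fact j\<close>
    cancel against \<open>fact (j + 1)\<close>.\<close>
  have nth: "fps_nth (fps_deriv (A n)) j = (-1) ^ j * gen_harmonic n (Suc j)" for n j
    by (simp add: A_def del: of_nat_Suc)
  \<comment> \<open>Only the last summand of the harmonic numbers survives in the difference,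
    leaving the geometric series of \<open>c / (1 + c * X)\<close> with
    \<open>c = 1 / (n + 1)\<close>; the denominator is cleared to avoid inverses.\<close>
  have step: "(1 + fps_const (1 / real (Suc n)) * fps_X) * (fps_deriv (A (Suc n)) - fps_deriv (A n))
      = fps_const (1 / real (Suc n))" for n
  proof (rule fps_ext)
    fix j
    have "fps_deriv (A (Suc n)) - fps_deriv (A n)
        = Abs_fps (\<lambda>j. (-1) ^ j * (1 / real (Suc n)) ^ Suc j)"
      by (rule fps_ext, unfold fps_sub_nth nth)
        (simp add: gen_harmonic_def algebra_simps power_one_over del: of_nat_Suc)
    then show "fps_nth ((1 + fps_const (1 / real (Suc n)) * fps_X)
        * (fps_deriv (A (Suc n)) - fps_deriv (A n))) j = fps_nth (fps_const (1 / real (Suc n))) j"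
      by (cases j) (simp_all add: distrib_right mult.assoc del: of_nat_Suc)
  qed
  show "fps_deriv (\<Prod>k=1..n. 1 + fps_const (1 / real k) * fps_X)
      = (\<Prod>k=1..n. 1 + fps_const (1 / real k) * fps_X) * fps_deriv (Abs_fps (\<lambda>j. if j = 0 then 0
       else (-1) ^ (j - 1) * fact (j - 1) * gen_harmonic n j / fact j))"
    unfolding A_def[symmetric]
  proof (induction n)
    case 0
    show ?case by (simp add: A_def gen_harmonic_def fps_eq_iff)
  next
    case (Suc n)
    define c where "c = fps_const (1 / real (Suc n))"
    define P where "P = (\<Prod>k=1..n. 1 + fps_const (1 / real k) * fps_X)"
    have P: "(\<Prod>k=1..Suc n. 1 + fps_const (1 / real k) * fps_X) = P * (1 + c * fps_X)"
      by (simp add: P_def c_def)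
    have "fps_deriv (P * (1 + c * fps_X)) = P * c + P * fps_deriv (A n) * (1 + c * fps_X)"
      using Suc[folded P_def] by (simp add: c_def)
    \<comment> \<open>Multiplying \<open>step\<close> by \<open>P\<close> rewrites the term
      \<open>P * c\<close> as \<open>P * (1 + c * X)\<close> times the increment of
      \<open>A'\<close>.\<close>
    also have "\<dots> = P * (1 + c * fps_X) * fps_deriv (A (Suc n))"
      using arg_cong[OF step[of n, folded c_def], of "\<lambda>t. P * t"] by (simp add: algebra_simps)
    finally show ?case by (simp only: P)
  qed
  show "fps_nth (\<Prod>k=1..n. 1 + fps_const (1 / real k) * fps_X) 0 = 1"
    by (induction n) simp_all
qed simp

text \<open>Coefficient form of the substitution \<open>x = lam * t\<close>: each factor becomes
  \<open>x + k * lam = k * lam * (1 + t / k)\<close>, and the constants multiply to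
  \<open>fact n * lam ^ n\<close>. The power \<open>lam ^ r\<close> stays on the left so that
  nothing is divided by \<open>lam\<close>.\<close>

lemma coeff_prod_linear_scaled:
  fixes lam :: real
  shows "coeff (\<Prod>k=1..n. [:real k * lam, 1:]) r * lam ^ r
     = fact n * lam ^ n * fps_nth (\<Prod>k=1..n. 1 + fps_const (1 / real k) * fps_X) r"
proof (induction n arbitrary: r)
  case 0
  show ?case by (cases r) auto
next
  case (Suc n)
  define P where "P = (\<Prod>k=1..n. 1 + fps_const (1 / real k) * fps_X)"
  define Q where "Q = (\<Prod>k=1..n. [:real k * lam, 1:])"
  have IH: "coeff Q r * lam ^ r = fact n * lam ^ n * fps_nth P r" for r
    using Suc unfolding P_def Q_def .
  have "coeff (Q * [:real (Suc n) * lam, 1:]) r * lam ^ r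
      = fact (Suc n) * lam ^ Suc n * fps_nth (P * (1 + fps_const (1 / real (Suc n)) * fps_X)) r"
  proof (cases r)
    case 0
    then show ?thesis using IH[of 0] by (simp add: algebra_simps)
  next
    case (Suc s)
    \<comment> \<open>Since \<open>r = s + 1\<close>, one \<open>lam\<close> is split off
      \<open>lam ^ r\<close> in the shifted term, so that the induction hypothesis applies at both
      \<open>r\<close> and \<open>s\<close>.\<close>
    have "coeff (Q * [:real (Suc n) * lam, 1:]) r * lam ^ r
        = real (Suc n) * lam * (coeff Q r * lam ^ r) + lam * (coeff Q s * lam ^ s)"
      by (simp add: Suc algebra_simps del: of_nat_Suc)
    also have "\<dots> = fact (Suc n) * lam ^ Suc n * (fps_nth P r + fps_nth P s / real (Suc n))"
      unfolding IH by (simp add: field_simps del: of_nat_Suc)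
    also have "fps_nth P r + fps_nth P s / real (Suc n)
        = fps_nth (P * (1 + fps_const (1 / real (Suc n)) * fps_X)) r"
      by (simp add: Suc distrib_left mult.left_commute[of P] del: of_nat_Suc)
    finally show ?thesis .
  qed
  then show ?case by (simp add: P_def Q_def)
qed

text \<open>The factor for \<open>i = 0\<close> is the indeterminate itself; splitting it off shifts
  the coefficient index by one and leaves the factors with \<open>k\<close> from 1 to
  \<open>n\<close>.\<close>

lemma deg_stirling1_Suc_Suc:
  "deg_stirling1 lam (Suc n) (Suc r) = coeff (\<Prod>k=1..n. [:real k * lam, 1:]) r"
proof -
  have "deg_rising [:lam:] (Suc n) [:0, 1:] = [:0, 1:] * (\<Prod>k=1..n. [:real k * lam, 1:])"
    unfolding deg_rising_def prod.lessThan_Suc_shift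
    by (simp add: of_nat_poly prod.atLeast1_atMost_eq mult.commute del: of_nat_Suc)
  then show ?thesis by (simp add: deg_stirling1_def)
qed

theorem theorem2:
  fixes lam :: real and n r :: nat
  assumes "lam \<noteq> 0" and "r \<le> n"
  shows "deg_stirling1 lam (n + 1) (r + 1) =
    fact n / fact r * lam ^ (n - r) *
      complete_bell r (\<lambda>i. (-1) ^ (i - 1) * fact (i - 1) * gen_harmonic n i)"
proof -
  let ?P = "\<Prod>k=1..n. 1 + fps_const (1 / real k) * fps_X"
  have "deg_stirling1 lam (n + 1) (r + 1) * lam ^ r = fact n * lam ^ n * fps_nth ?P r"
    using coeff_prod_linear_scaled[of lam n r] by (simp add: deg_stirling1_Suc_Suc)
  \<comment> \<open>By \<open>r \<le> n\<close> the natural subtraction is not truncated;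
    \<open>lam ^ r\<close> then cancels because \<open>lam\<close> is nonzero.\<close>
  also have "lam ^ n = lam ^ (n - r) * lam ^ r"
    using assms(2) by (simp flip: power_add)
  finally have "deg_stirling1 lam (n + 1) (r + 1) = fact n * lam ^ (n - r) * fps_nth ?P r"
    using assms(1) by simp
  also have "fps_nth ?P r
      = complete_bell r (\<lambda>i. (-1) ^ (i - 1) * fact (i - 1) * gen_harmonic n i) / fact r"
    unfolding complete_bell_def complete_bell_egf_harmonic by simp
  finally show ?thesis by simp
qed

end
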